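(* Let $k_1,k_2\ge1$ be integers. For all $n\ge k_2$, $$P_{q,\theta}\big(L_n^{(1)}\le k_1,\ L_n^{(0)}\ge k_2\big)=\sum_{i=k_2}^{n}\theta^{n-i}\prod_{j=1}^{i}(1-\theta q^{j-1})\sum_{s=1}^{i-k_2+1}\Big[M_{q,0,k_2}^{k_1+1,\infty}(n-i,i,s)+E_{q,0,k_2}^{k_1+1,\infty}(n-i,i,s)+N_{q,0,k_2}^{k_1+1,\infty}(n-i,i,s+1)+F_{q,0,k_2}^{k_1+1,\infty}(n-i,i,s)\Big].$$
   Context: Model: fix reals $0\le\theta\le1$ and $0<q<1$. $(X_j)_{j\ge1}$ is a sequence of $\{0,1\}$-valued random variables (1 = success, 0 = failure) with law $P_{q,\theta}$ such that, conditionally on $X_1,\dots,X_{j-1}$ containing exactly $i-1$ zeros, $X_j=0$ with probability $1-\theta q^{i-1}$ and $X_j=1$ with probability $\theta q^{i-1}$. Conventions: $0^0=1$, empty products are 1, empty sums are 0. $L_n^{(1)}$ and $L_n^{(0)}$ are the lengths of the longest run of consecutive successes and of consecutive failures, respectively, in $X_1,\dots,X_n$ ($0$ if there is none). $S_{r,s}^{k}$ denotes the set of $s$-tuples of positive integers with sum $r$ and maximum $>k$ (for $k=0$ the maximum condition is vacuous, and $S_{0,0}^0$ consists of the empty tuple). Combinatorial sums, for a positive integer $\kappa$ (first superscript), integers $m,r$ and $s\ge1$: - $E_{q,0,k_2}^{\kappa,\infty}(m,r,s)=\sum q^{\sum_{j=1}^{s-1}(y_1+\dots+y_j)x_j}$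 over $(x_1,\dots,x_{s-1})\in S_{m,s-1}^0$ with all $x_j<\kappa$ and $(y_1,\dots,y_s)\in S_{r,s}^{k_2-1}$; - $F_{q,0,k_2}^{\kappa,\infty}(m,r,s)=\sum q^{\sum_{j=2}^{s}(y_1+\dots+y_{j-1})x_j}$ over $(x_1,\dots,x_s)\in S_{m,s}^0$ with all $x_j<\kappa$ and $(y_1,\dots,y_s)\in S_{r,s}^{k_2-1}$; - $M_{q,0,k_2}^{\kappa,\infty}(m,r,s)=\sum q^{\sum_{j=1}^{s}(y_1+\dots+y_j)x_j}$ over $(x_1,\dots,x_s)\in S_{m,s}^0$ with all $x_j<\kappa$ and $(y_1,\dots,y_s)\in S_{r,s}^{k_2-1}$; - $N_{q,0,k_2}^{\kappa,\infty}(m,r,s)=\sum q^{\sum_{j=2}^{s}(y_1+\dots+y_{j-1})x_j}$ over $(x_1,\dots,x_s)\in S_{m,s}^0$ with all $x_j<\kappa$ and $(y_1,\dots,y_{s-1})\in S_{r,s-1}^{k_2-1}$. *)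

theory Defs
  imports "HOL-Probability.Probability"
begin

(* Only X 1, X 2, ... matter; X 0 is unconstrained.  The conditioning is on the entire history
   X 1, ..., X (j-1), the number of zeros of which determines the law of X j.  Histories of
   probability 0 are exempt, since cond_prob is 0 there by convention. *)
locale q_bernoulli_trials = prob_space M for M :: "'a measure" +
  fixes X :: "nat \<Rightarrow> 'a \<Rightarrow> nat" and q \<theta> :: real
  assumes X_measurable: "\<And>j. j \<ge> 1 \<Longrightarrow> X j \<in> measurable M (count_space {0, 1})"
    and X_failure: "\<And>j x. j \<ge> 1 \<Longrightarrow>
      \<P>(\<omega> in M. \<forall>l\<in>{1..<j}. X l \<omega> = x l) > 0 \<Longrightarrow>
      \<P>(\<omega> in M. X j \<omega> = 0 \<bar> \<forall>l\<in>{1..<j}. X l \<omega> = x l)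
        = 1 - \<theta> * q ^ card {l \<in> {1..<j}. x l = 0}"
    and X_success: "\<And>j x. j \<ge> 1 \<Longrightarrow>
      \<P>(\<omega> in M. \<forall>l\<in>{1..<j}. X l \<omega> = x l) > 0 \<Longrightarrow>
      \<P>(\<omega> in M. X j \<omega> = 1 \<bar> \<forall>l\<in>{1..<j}. X l \<omega> = x l)
        = \<theta> * q ^ card {l \<in> {1..<j}. x l = 0}"

(* Longest run of the value b among x 1, ..., x n; the set always contains 0. *)
definition longest_run :: "(nat \<Rightarrow> nat) \<Rightarrow> nat \<Rightarrow> nat \<Rightarrow> nat" where
  "longest_run x b n = Max {l. \<exists>a. a + l \<le> n \<and> (\<forall>j\<in>{a+1..a+l}. x j = b)}"

(* S_{r,s}^k, with s-tuples as lists of length s.  Lists are indexed from 0, so x_j is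
   xs ! (j - 1) and y_1 + ... + y_j is sum_list (take j ys). *)
definition S_tuples :: "nat \<Rightarrow> nat \<Rightarrow> nat \<Rightarrow> nat list set" where
  "S_tuples k r s = {xs. length xs = s \<and> (\<forall>x\<in>set xs. x \<ge> 1) \<and> sum_list xs = r \<and>
     (k = 0 \<or> (xs \<noteq> [] \<and> Max (set xs) > k))}"

(* Sums with subscripts q,0,k2 and superscripts kappa,infinity. *)
definition E_sum :: "real \<Rightarrow> nat \<Rightarrow> nat \<Rightarrow> nat \<Rightarrow> nat \<Rightarrow> nat \<Rightarrow> real" where
  "E_sum q k2 \<kappa> m r s =
     (\<Sum>(xs, ys) \<in> {xs \<in> S_tuples 0 m (s - 1). \<forall>x\<in>set xs. x < \<kappa>} \<times> S_tuples (k2 - 1) r s.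
        q ^ (\<Sum>j=1..s-1. sum_list (take j ys) * xs ! (j - 1)))"

definition F_sum :: "real \<Rightarrow> nat \<Rightarrow> nat \<Rightarrow> nat \<Rightarrow> nat \<Rightarrow> nat \<Rightarrow> real" where
  "F_sum q k2 \<kappa> m r s =
     (\<Sum>(xs, ys) \<in> {xs \<in> S_tuples 0 m s. \<forall>x\<in>set xs. x < \<kappa>} \<times> S_tuples (k2 - 1) r s.
        q ^ (\<Sum>j=2..s. sum_list (take (j - 1) ys) * xs ! (j - 1)))"

definition M_sum :: "real \<Rightarrow> nat \<Rightarrow> nat \<Rightarrow> nat \<Rightarrow> nat \<Rightarrow> nat \<Rightarrow> real" where
  "M_sum q k2 \<kappa> m r s =
     (\<Sum>(xs, ys) \<in> {xs \<in> S_tuples 0 m s. \<forall>x\<in>set xs. x < \<kappa>} \<times> S_tuples (k2 - 1) r s.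
        q ^ (\<Sum>j=1..s. sum_list (take j ys) * xs ! (j - 1)))"

definition N_sum :: "real \<Rightarrow> nat \<Rightarrow> nat \<Rightarrow> nat \<Rightarrow> nat \<Rightarrow> nat \<Rightarrow> real" where
  "N_sum q k2 \<kappa> m r s =
     (\<Sum>(xs, ys) \<in> {xs \<in> S_tuples 0 m s. \<forall>x\<in>set xs. x < \<kappa>} \<times> S_tuples (k2 - 1) r (s - 1).
        q ^ (\<Sum>j=2..s. sum_list (take (j - 1) ys) * xs ! (j - 1)))"

end

theory Submission
  imports Defs "HOL-Library.Sublist"
begin

text \<open>
  A fixed \<open>0\<close>-\<open>1\<close> word of length \<open>n\<close> with \<open>i\<close> zeros has an explicit probability. The failures,
  in order of occurrence, contribute the factors \<open>1 - \<theta> * q ^ (j - 1)\<close> for \<open>j = 1, \<dots>, i\<close>,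
  wherever they stand; a success preceded by \<open>c\<close> failures contributes \<open>\<theta> * q ^ c\<close>. Hence the
  word has probability \<open>\<theta> ^ (n - i) * (\<Prod>j=1..i. 1 - \<theta> * q ^ (j - 1)) * q ^ e\<close>, where \<open>e\<close> counts
  the pairs of a failure and a later success (lemma \<open>prob_word\<close>). Only \<open>e\<close> depends on the
  arrangement, so the theorem reduces, for each \<open>i\<close>, to summing \<open>q ^ e\<close> over the words with \<open>i\<close>
  zeros that satisfy the two conditions on runs.

  Such a word is determined by its first letter and by the lengths of its maximal runs: the
  lengths \<open>x\<^sub>1, x\<^sub>2, \<dots>\<close> of the runs of successes and \<open>y\<^sub>1, y\<^sub>2, \<dots>\<close> of the runs of failures are
  arbitrary positive integers, subject only to the two kinds of runs alternating
  (lemma \<open>bij_betw_weave\<close>). The conditions on the longest runs say that all \<open>x\<^sub>j \<le> k1\<close> and that some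
  \<open>y\<^sub>j \<ge> k2\<close>, and a run of \<open>x\<^sub>j\<close> successes preceded by the failure runs
  \<open>y\<^sub>1, \<dots>, y\<^sub>l\<close> adds \<open>(y\<^sub>1 + \<dots> + y\<^sub>l) * x\<^sub>j\<close> to \<open>e\<close> (lemma \<open>crossings_weave\<close>). The four sums are the
  four choices of first and last letter, with \<open>s\<close> the number of failure runs: \<open>M\<close> is failure
  first and success last, \<open>E\<close> failure first and last, \<open>N\<close> (at \<open>s + 1\<close>) success first and last,
  \<open>F\<close> success first and failure last. One failure run has length at least \<open>k2\<close> and the others
  at least \<open>1\<close>, so \<open>s\<close> ranges up to \<open>i - k2 + 1\<close> (lemma \<open>sum_words\<close>).
\<close>

section \<open>Words as alternating runs\<close>

text \<open>
  Runs of \<open>a\<close> and of \<open>b\<close> alternate, starting with \<open>a\<close>; the two lists of lengths swap roles at each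
  recursive call. This treats words starting with a success and words starting with a failure
  by the same induction.
\<close>

function weave :: "'b \<Rightarrow> 'b \<Rightarrow> nat list \<Rightarrow> nat list \<Rightarrow> 'b list" where
  "weave a b [] ts = []"
| "weave a b (r # rs) ts = replicate r a @ weave b a ts rs"
  by pat_completeness auto
termination
  by (relation "Wellfounded.measure (\<lambda>(a, b, rs, ts). length rs + length ts)") auto

text \<open>The pairs of length lists for which \<open>weave\<close> uses up both lists, ending in either letter.\<close>

definition alternating :: "nat list \<Rightarrow> nat list \<Rightarrow> bool" where
  "alternating rs ts \<longleftrightarrow> length rs = length ts \<or> length rs = Suc (length ts)"

definition composition :: "nat list \<Rightarrow> bool" where
  "composition rs \<longleftrightarrow> (\<forall>r\<in>set rs. 1 \<le> r)"

lemma composition_simps [simp]: "composition []" "composition (r # rs) \<longleftrightarrow> 1 \<le> r \<and> composition rs"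
  by (auto simp: composition_def)

lemma alternating_simps [simp]:
  "alternating [] ts \<longleftrightarrow> ts = []"
  "alternating (r # rs) ts \<longleftrightarrow> alternating ts rs"
  by (auto simp: alternating_def)

lemma weave_hd: "composition rs \<Longrightarrow> weave a b rs ts = [] \<or> hd (weave a b rs ts) = a"
  by (cases rs) (auto simp: hd_append)

lemma weave_eq_Nil_iff: "composition rs \<Longrightarrow> alternating rs ts \<Longrightarrow> weave a b rs ts = [] \<longleftrightarrow> rs = []"
  by (cases rs) auto

lemma set_weave: "set (weave a b rs ts) \<subseteq> {a, b}"
  by (induction a b rs ts rule: weave.induct) (auto split: if_splits)

lemma count_list_replicate: "count_list (replicate r a) c = (if a = c then r else 0)"
  by (induction r) auto

lemma count_weave:
  assumes "a \<noteq> b" "alternating rs ts"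
  shows "count_list (weave a b rs ts) a = sum_list rs \<and> count_list (weave a b rs ts) b = sum_list ts"
  using assms by (induction a b rs ts rule: weave.induct) (auto simp: count_list_replicate)

text \<open>Splitting off the first maximal run of a word is unambiguous, because what remains does not
  start with the same letter.\<close>

lemma replicate_append_eq_iff:
  assumes "u = [] \<or> hd u \<noteq> a" "v = [] \<or> hd v \<noteq> a"
  shows "replicate m a @ u = replicate n a @ v \<longleftrightarrow> m = n \<and> u = v"
proof (induction m arbitrary: n)
  case 0
  show ?case
    using assms(1) by (cases n; cases u) auto
next
  case (Suc m)
  show ?case
  proof (cases n)
    case 0
    then show ?thesis using assms(2) by (cases v) auto
  next
    case (Suc n')
    then show ?thesis by (simp add: Suc.IH)
  qed
qed

lemma weave_inj:
  assumes "a \<noteq> b" "composition rs" "composition ts" "alternating rs ts"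
    and "composition rs'" "composition ts'" "alternating rs' ts'"
    and "weave a b rs ts = weave a b rs' ts'"
  shows "rs = rs' \<and> ts = ts'"
  using assms
proof (induction a b rs ts arbitrary: rs' ts' rule: weave.induct)
  case (1 a b ts)
  have "weave a b rs' ts' = []"
    using "1.prems"(8) by (metis weave.simps(1))
  then have "rs' = []"
    using weave_eq_Nil_iff[OF "1.prems"(5,7), of a b] by simp
  then show ?case
    using "1.prems"(4,7) by simp
next
  case (2 a b r rs ts)
  have "weave a b rs' ts' \<noteq> []"
    unfolding "2.prems"(8)[symmetric] using "2.prems"(2) by simp
  then obtain r' us where rs': "rs' = r' # us"
    by (cases rs') auto
  have prems: "composition rs" "composition ts" "alternating ts rs" "b \<noteq> a"
    "composition us" "composition ts'" "alternating ts' us"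
    using "2.prems"(1-7) by (auto simp: rs')
  have "replicate r a @ weave b a ts rs = replicate r' a @ weave b a ts' us"
    using "2.prems"(8) by (simp add: rs')
  moreover have "weave b a ts rs = [] \<or> hd (weave b a ts rs) \<noteq> a"
    "weave b a ts' us = [] \<or> hd (weave b a ts' us) \<noteq> a"
    using weave_hd[of ts b a rs] weave_hd[of ts' b a us] prems by auto
  ultimately have "r = r'" "weave b a ts rs = weave b a ts' us"
    by (simp_all add: replicate_append_eq_iff)
  moreover from this(2) have "ts = ts' \<and> rs = us"
    using prems by (intro "2.IH")
  ultimately show ?case by (simp add: rs')
qed

text \<open>A letter put in front of a word either lengthens its first run or opens a new run of length
  \<open>1\<close>, in which case the two length lists exchange roles.\<close>

lemma weave_surj:
  assumes "a \<noteq> b" "set zs \<subseteq> {a, b}" "zs = [] \<or> hd zs = a"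
  shows "\<exists>rs ts. composition rs \<and> composition ts \<and> alternating rs ts \<and> weave a b rs ts = zs"
  using assms
proof (induction zs arbitrary: a b)
  case Nil
  show ?case by (intro exI[of _ "[]"]) simp
next
  case (Cons z zs)
  then have z: "z = a" by simp
  consider "zs = [] \<or> hd zs = b" | "zs \<noteq> []" "hd zs = a"
    using Cons.prems by (cases zs) auto
  then show ?case
  proof cases
    case 1
    then obtain rs ts where "composition rs" "composition ts" "alternating rs ts" "weave b a rs ts = zs"
      using Cons.IH[of b a] Cons.prems by auto
    then show ?thesis
      by (intro exI[of _ "1 # ts"] exI[of _ rs]) (simp add: z)
  next
    case 2
    then obtain rs ts where *: "composition rs" "composition ts" "alternating rs ts" "weave a b rs ts = zs"
      using Cons.IH[of a b] Cons.prems by auto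
    with 2 obtain r us where "rs = r # us"
      by (cases rs) auto
    with * show ?thesis
      by (intro exI[of _ "Suc r # us"] exI[of _ ts]) (auto simp: z)
  qed
qed

text \<open>Run-length encoding: positivity of the lengths makes the runs maximal, hence unique.\<close>

lemma bij_betw_weave:
  assumes "a \<noteq> b"
  shows "bij_betw (\<lambda>(rs, ts). weave a b rs ts)
    {(rs, ts). composition rs \<and> composition ts \<and> alternating rs ts}
    {zs. set zs \<subseteq> {a, b} \<and> (zs = [] \<or> hd zs = a)}"
  unfolding bij_betw_def
proof
  show "inj_on (\<lambda>(rs, ts). weave a b rs ts) {(rs, ts). composition rs \<and> composition ts \<and> alternating rs ts}"
  proof (rule inj_onI, clarify)
    fix rs ts rs' ts'
    assume "composition rs" "composition ts" "alternating rs ts"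
      "composition rs'" "composition ts'" "alternating rs' ts'" "weave a b rs ts = weave a b rs' ts'"
    then show "rs = rs' \<and> ts = ts'"
      by (intro weave_inj[OF assms])
  qed
  show "(\<lambda>(rs, ts). weave a b rs ts) ` {(rs, ts). composition rs \<and> composition ts \<and> alternating rs ts}
    = {zs. set zs \<subseteq> {a, b} \<and> (zs = [] \<or> hd zs = a)}" (is "?L = ?R")
  proof
    show "?L \<subseteq> ?R"
      using weave_hd[of _ a b] set_weave[of a b] by clarsimp
    show "?R \<subseteq> ?L"
    proof
      fix zs assume "zs \<in> ?R"
      then obtain rs ts where "composition rs" "composition ts" "alternating rs ts" "weave a b rs ts = zs"
        using weave_surj[OF assms, of zs] by blast
      then show "zs \<in> ?L"
        by (intro image_eqI[of _ _ "(rs, ts)"]) auto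
    qed
  qed
qed

section \<open>Long runs\<close>

lemma prefix_replicate_append:
  assumes "zs = [] \<or> hd zs \<noteq> a"
  shows "prefix (replicate l a) (replicate r a @ zs) \<longleftrightarrow> l \<le> r"
  using assms
proof (induction r arbitrary: l)
  case 0
  then show ?case by (cases l; cases zs) auto
next
  case (Suc r)
  then show ?case by (cases l) auto
qed

text \<open>A block of equal letters cannot cross the end of a maximal run.\<close>

lemma sublist_replicate_same:
  assumes "zs = [] \<or> hd zs \<noteq> a" "0 < l"
  shows "sublist (replicate l a) (replicate r a @ zs) \<longleftrightarrow> l \<le> r \<or> sublist (replicate l a) zs"
proof (induction r)
  case 0
  then show ?case using assms by simp
next
  case (Suc r)
  then show ?case
    using prefix_replicate_append[OF assms(1), of l "Suc r"] by (auto simp: sublist_Cons_right)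
qed

lemma sublist_replicate_other:
  assumes "a \<noteq> b" "0 < l"
  shows "sublist (replicate l b) (replicate r a @ zs) \<longleftrightarrow> sublist (replicate l b) zs"
proof (induction r)
  case (Suc r)
  then show ?case using assms by (cases l) (auto simp: sublist_Cons_right)
qed simp

lemma sublist_replicate_weave:
  assumes "a \<noteq> b" "composition rs" "composition ts" "alternating rs ts" "0 < l"
  shows "(sublist (replicate l a) (weave a b rs ts) \<longleftrightarrow> (\<exists>r\<in>set rs. l \<le> r)) \<and>
    (sublist (replicate l b) (weave a b rs ts) \<longleftrightarrow> (\<exists>t\<in>set ts. l \<le> t))"
  using assms
proof (induction a b rs ts rule: weave.induct)
  case (2 a b r rs ts)
  have "weave b a ts rs = [] \<or> hd (weave b a ts rs) \<noteq> a"
    using weave_hd[of ts b a rs] 2 by auto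
  then have "sublist (replicate l a) (weave a b (r # rs) ts) \<longleftrightarrow>
      l \<le> r \<or> sublist (replicate l a) (weave b a ts rs)"
    using 2 by (simp add: sublist_replicate_same)
  moreover have "sublist (replicate l b) (weave a b (r # rs) ts) \<longleftrightarrow>
      sublist (replicate l b) (weave b a ts rs)"
    using 2 by (simp only: weave.simps sublist_replicate_other not_False_eq_True)
  moreover have "(sublist (replicate l b) (weave b a ts rs) \<longleftrightarrow> (\<exists>t\<in>set ts. l \<le> t)) \<and>
      (sublist (replicate l a) (weave b a ts rs) \<longleftrightarrow> (\<exists>r\<in>set rs. l \<le> r))"
    using "2.prems" by (intro "2.IH") auto
  ultimately show ?case
    by simp
qed simp

section \<open>Failures before successes\<close>

text \<open>The number of pairs of a \<open>0\<close> and a later nonzero letter, when \<open>c\<close> further zeros precede the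
  word. The parameter \<open>c\<close> lets a word be consumed from the left.\<close>

primrec crossings :: "nat \<Rightarrow> nat list \<Rightarrow> nat" where
  "crossings c [] = 0"
| "crossings c (z # zs) = (if z = 0 then crossings (Suc c) zs else c + crossings c zs)"

lemma crossings_append_single:
  "crossings c (zs @ [z]) = crossings c zs + (if z = 0 then 0 else c + count_list zs 0)"
  by (induction zs arbitrary: c) auto

lemma crossings_replicate_append:
  "crossings c (replicate r 0 @ zs) = crossings (c + r) zs"
  "crossings c (replicate r 1 @ zs) = r * c + crossings c zs"
  by (induction r arbitrary: c) auto

text \<open>Both formulas are proved together: peeling off a first run of zeros turns the first into the
  second with \<open>c\<close> increased, and peeling off a first run of ones turns the second into the first.\<close>

lemma crossings_weave:
  "alternating ys xs \<Longrightarrow> crossings c (weave 0 1 ys xs) =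
     (\<Sum>j<length xs. (c + sum_list (take (Suc j) ys)) * xs ! j)"
  "alternating xs ys \<Longrightarrow> crossings c (weave 1 0 xs ys) =
     (\<Sum>j<length xs. (c + sum_list (take j ys)) * xs ! j)"
proof (induction "length xs + length ys" arbitrary: c xs ys rule: less_induct)
  case less
  {
    case 1
    show ?case
    proof (cases ys)
      case Nil
      with 1 show ?thesis by simp
    next
      case (Cons y ys')
      with 1 less(2)[of xs ys' "c + y"] show ?thesis
        by (simp add: crossings_replicate_append add.assoc)
    qed
  next
    case 2
    show ?case
    proof (cases xs)
      case Nil
      then show ?thesis by simp
    next
      case (Cons x xs')
      with 2 less(1)[of xs' ys c] show ?thesis
        by (simp add: crossings_replicate_append[simplified] sum.lessThan_Suc_shift mult.commute del: sum.lessThan_Suc)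
    qed
  }
qed

section \<open>Longest runs\<close>

text \<open>The lengths of constant blocks are closed downwards: a block of length \<open>k\<close> can be cut out of a
  longest one.\<close>

lemma longest_run_ge_iff:
  "k \<le> longest_run x b n \<longleftrightarrow> sublist (replicate k b) (map x [1..<Suc n])"
proof -
  let ?L = "{l. \<exists>a. a + l \<le> n \<and> (\<forall>j\<in>{a+1..a+l}. x j = b)}"
  have fin: "finite ?L"
    by (rule finite_subset[of _ "{..n}"]) auto
  have zero: "0 \<in> ?L" by auto
  have "k \<le> longest_run x b n \<longleftrightarrow> k \<in> ?L"
  proof
    assume le: "k \<le> longest_run x b n"
    have "longest_run x b n \<in> ?L"
      unfolding longest_run_def using fin zero by (intro Max_in) blast+
    then obtain a where "a + longest_run x b n \<le> n" "\<forall>j\<in>{a+1..a+longest_run x b n}. x j = b"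
      by blast
    with le show "k \<in> ?L" by (auto intro!: exI[of _ a])
  next
    assume "k \<in> ?L"
    then show "k \<le> longest_run x b n"
      unfolding longest_run_def using fin by (intro Max_ge)
  qed
  also have "\<dots> \<longleftrightarrow> sublist (replicate k b) (map x [1..<Suc n])"
  proof
    assume "k \<in> ?L"
    then obtain a where a: "a + k \<le> n" "\<forall>j\<in>{a+1..a+k}. x j = b" by auto
    have "map x [1..<Suc n] = map x [1..<a+1] @ map x [a+1..<a+1+k] @ map x [a+1+k..<Suc n]"
      using upt_add_eq_append[of 1 "a+1" "n-a"] upt_add_eq_append[of "a+1" "a+1+k" "n-a-k"] a(1)
      by (simp del: upt_Suc)
    moreover have "map x [a+1..<a+1+k] = replicate k b"
      using a(2) by (simp add: list_eq_iff_nth_eq del: upt_Suc)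
    ultimately show "sublist (replicate k b) (map x [1..<Suc n])"
      by (simp only: sublist_appendI)
  next
    assume "sublist (replicate k b) (map x [1..<Suc n])"
    then obtain us vs where eq: "map x [1..<Suc n] = us @ replicate k b @ vs"
      by (auto simp: sublist_def)
    from arg_cong[OF eq, of length] have len: "n = length us + k + length vs"
      by (simp del: upt_Suc)
    have "x j = b" if "j \<in> {length us + 1..length us + k}" for j
    proof -
      have "x j = map x [1..<Suc n] ! (j - 1)"
        using that len by (subst nth_map_upt) auto
      also have "\<dots> = b"
        unfolding eq using that by (auto simp: nth_append)
      finally show ?thesis .
    qed
    with len show "k \<in> ?L" by (auto intro!: exI[of _ "length us"])
  qed
  finally show ?thesis .
qed

section \<open>The combinatorial sums as sums over words\<close>

text \<open>The run lengths, \<open>xs\<close> of successes and \<open>ys\<close> of failures, of words with \<open>m\<close> successes and \<open>i\<close>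
  failures, no success run of length \<open>\<kappa>\<close> or more, and some failure run of length at least \<open>k\<close>.
  The number of runs is left open.\<close>

definition admissible :: "nat \<Rightarrow> nat \<Rightarrow> nat \<Rightarrow> nat \<Rightarrow> nat list \<Rightarrow> nat list \<Rightarrow> bool" where
  "admissible \<kappa> k m i xs ys \<longleftrightarrow>
     composition xs \<and> sum_list xs = m \<and> (\<forall>x\<in>set xs. x < \<kappa>) \<and>
     composition ys \<and> sum_list ys = i \<and> (\<exists>y\<in>set ys. k \<le> y)"

text \<open>For \<open>k = 1\<close> the tuples carry no condition on their maximum; a nonempty tuple of positive
  integers then has an entry \<open>\<ge> 1\<close> anyway, which is where \<open>s \<ge> 1\<close> enters.\<close>

lemma index_set_eq:
  assumes "1 \<le> k" "1 \<le> s"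
  shows "{xs \<in> S_tuples 0 m t. \<forall>x\<in>set xs. x < \<kappa>} \<times> S_tuples (k - 1) i s =
    {(xs, ys). admissible \<kappa> k m i xs ys \<and> length xs = t \<and> length ys = s}"
proof -
  have "(k - 1 = 0 \<or> ys \<noteq> [] \<and> Max (set ys) > k - 1) \<longleftrightarrow> (\<exists>y\<in>set ys. k \<le> y)"
    if "composition ys" "length ys = s" for ys
  proof -
    have ne: "ys \<noteq> []" using that assms by auto
    have "k - 1 < Max (set ys) \<longleftrightarrow> k \<le> Max (set ys)"
      using assms by linarith
    also have "\<dots> \<longleftrightarrow> (\<exists>y\<in>set ys. k \<le> y)"
      using ne by (simp add: Max_ge_iff)
    finally have "k - 1 < Max (set ys) \<longleftrightarrow> (\<exists>y\<in>set ys. k \<le> y)" .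
    moreover have "\<exists>y\<in>set ys. k \<le> y" if "k = 1"
      using ne \<open>composition ys\<close> that by (cases ys) auto
    moreover have "k - 1 = 0 \<longleftrightarrow> k = 1"
      using assms by linarith
    ultimately show ?thesis using ne by blast
  qed
  then have "S_tuples (k - 1) i s =
      {ys. composition ys \<and> sum_list ys = i \<and> (\<exists>y\<in>set ys. k \<le> y) \<and> length ys = s}"
    unfolding S_tuples_def composition_def by blast
  moreover have "S_tuples 0 m t = {xs. composition xs \<and> sum_list xs = m \<and> length xs = t}"
    unfolding S_tuples_def composition_def by blast
  ultimately show ?thesis
    unfolding admissible_def by blast
qed

lemma crossings_weave_failure_first:
  assumes "alternating ys xs" "length xs = t"
  shows "crossings 0 (weave 0 1 ys xs) = (\<Sum>j=1..t. sum_list (take j ys) * xs ! (j - 1))"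
  using crossings_weave(1)[OF assms(1), of 0] assms(2)
  by (simp add: sum.atLeast1_atMost_eq)

lemma crossings_weave_success_first:
  assumes "alternating xs ys" "length xs = t"
  shows "crossings 0 (weave 1 0 xs ys) = (\<Sum>j=2..t. sum_list (take (j - 1) ys) * xs ! (j - 1))"
proof -
  \<comment> \<open>The first success run, at \<open>j = 1\<close>, is preceded by no failures.\<close>
  have "(\<Sum>j=2..t. sum_list (take (j - 1) ys) * xs ! (j - 1)) =
      (\<Sum>j=1..t. sum_list (take (j - 1) ys) * xs ! (j - 1))"
  proof (rule sum.mono_neutral_left)
    show "\<forall>j\<in>{1..t} - {2..t}. sum_list (take (j - 1) ys) * xs ! (j - 1) = 0"
    proof
      fix j assume "j \<in> {1..t} - {2..t}"
      then have "j = 1" by auto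
      then show "sum_list (take (j - 1) ys) * xs ! (j - 1) = 0" by simp
    qed
  qed auto
  then show ?thesis
    using crossings_weave(2)[OF assms(1), of 0] assms(2)
    by (simp add: sum.atLeast1_atMost_eq)
qed

lemma M_sum_eq:
  assumes "1 \<le> k" "1 \<le> s"
  shows "M_sum q k \<kappa> m i s =
    (\<Sum>(xs, ys) \<in> {(xs, ys). admissible \<kappa> k m i xs ys \<and> length xs = s \<and> length ys = s}.
      q ^ crossings 0 (weave 0 1 ys xs))"
  unfolding M_sum_def index_set_eq[OF assms]
  by (intro sum.cong refl) (auto simp: crossings_weave_failure_first alternating_def simp del: One_nat_def)

lemma E_sum_eq:
  assumes "1 \<le> k" "1 \<le> s"
  shows "E_sum q k \<kappa> m i s =
    (\<Sum>(xs, ys) \<in> {(xs, ys). admissible \<kappa> k m i xs ys \<and> length xs = s - 1 \<and> length ys = s}.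
      q ^ crossings 0 (weave 0 1 ys xs))"
  unfolding E_sum_def index_set_eq[OF assms]
proof (rule sum.cong[OF refl])
  fix p assume "p \<in> {(xs, ys). admissible \<kappa> k m i xs ys \<and> length xs = s - 1 \<and> length ys = s}"
  then obtain xs ys where p: "p = (xs, ys)" "length xs = s - 1" "length ys = s" by blast
  then have "alternating ys xs"
    unfolding alternating_def using assms by linarith
  then show "(case p of (xs, ys) \<Rightarrow> q ^ (\<Sum>j=1..s-1. sum_list (take j ys) * xs ! (j - 1))) =
      (case p of (xs, ys) \<Rightarrow> q ^ crossings 0 (weave 0 1 ys xs))"
    using p by (simp only: prod.case crossings_weave_failure_first)
qed

lemma F_sum_eq:
  assumes "1 \<le> k" "1 \<le> s"
  shows "F_sum q k \<kappa> m i s =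
    (\<Sum>(xs, ys) \<in> {(xs, ys). admissible \<kappa> k m i xs ys \<and> length xs = s \<and> length ys = s}.
      q ^ crossings 0 (weave 1 0 xs ys))"
  unfolding F_sum_def index_set_eq[OF assms]
  by (intro sum.cong refl) (auto simp: crossings_weave_success_first alternating_def simp del: One_nat_def)

lemma N_sum_Suc_eq:
  assumes "1 \<le> k" "1 \<le> s"
  shows "N_sum q k \<kappa> m i (s + 1) =
    (\<Sum>(xs, ys) \<in> {(xs, ys). admissible \<kappa> k m i xs ys \<and> length xs = s + 1 \<and> length ys = s}.
      q ^ crossings 0 (weave 1 0 xs ys))"
  unfolding N_sum_def add_diff_cancel_right' index_set_eq[OF assms]
  by (intro sum.cong refl) (auto simp: crossings_weave_success_first alternating_def simp del: One_nat_def)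

lemma length_le_sum_list: "composition xs \<Longrightarrow> length xs \<le> sum_list xs"
  by (induction xs) auto

text \<open>All parts other than \<open>y\<close> are at least \<open>1\<close>. This bounds the number of failure runs once one
  of them is long.\<close>

lemma add_length_le_sum_list:
  "composition ys \<Longrightarrow> y \<in> set ys \<Longrightarrow> y + length ys \<le> sum_list ys + 1"
  by (induction ys) (auto dest: length_le_sum_list)

lemma finite_admissible: "finite {(xs, ys). admissible \<kappa> k m i xs ys}"
proof (rule finite_subset)
  let ?L = "\<lambda>r. {xs. set xs \<subseteq> {..r} \<and> length xs \<le> r}"
  show "{(xs, ys). admissible \<kappa> k m i xs ys} \<subseteq> ?L m \<times> ?L i"
    by (auto simp: admissible_def intro: length_le_sum_list member_le_sum_list)
  show "finite (?L m \<times> ?L i)"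
    by (intro finite_cartesian_product finite_lists_length_le) auto
qed

text \<open>The range of \<open>s\<close> loses nothing: there is at least one failure run, namely the long one, and at
  most \<open>i - k + 1\<close> of them in total.\<close>

lemma sum_by_number_of_failure_runs:
  assumes "\<And>s. 1 \<le> s \<Longrightarrow>
    G s = (\<Sum>p \<in> {(xs, ys). admissible \<kappa> k m i xs ys \<and> R xs ys \<and> length ys = s}. h p)"
  shows "(\<Sum>s=1..i-k+1. G s) = (\<Sum>p \<in> {(xs, ys). admissible \<kappa> k m i xs ys \<and> R xs ys}. h p)"
proof -
  let ?S = "{(xs, ys). admissible \<kappa> k m i xs ys \<and> R xs ys}"
  have "finite ?S"
    by (rule finite_subset[OF _ finite_admissible[of \<kappa> k m i]]) auto
  moreover have "(length \<circ> snd) ` ?S \<subseteq> {1..i-k+1}"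
  proof (intro image_subsetI)
    fix p assume "p \<in> ?S"
    then obtain xs ys where p: "p = (xs, ys)" "admissible \<kappa> k m i xs ys" by blast
    then obtain y where y: "y \<in> set ys" "k \<le> y" "composition ys" "sum_list ys = i"
      unfolding admissible_def by blast
    then have "1 \<le> length ys" by (cases ys) auto
    with y add_length_le_sum_list[of ys y] p show "(length \<circ> snd) p \<in> {1..i-k+1}" by auto
  qed
  ultimately have "(\<Sum>s=1..i-k+1. sum h {p. p \<in> ?S \<and> (length \<circ> snd) p = s}) = sum h ?S"
    by (intro sum.group) auto
  moreover have "G s = sum h {p. p \<in> ?S \<and> (length \<circ> snd) p = s}" if "1 \<le> s" for s
    unfolding assms[OF that] by (intro sum.cong) auto
  ultimately show ?thesis by simp
qed

text \<open>The words encoded by \<open>admissible\<close> pairs of length lists.\<close>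

definition words :: "nat \<Rightarrow> nat \<Rightarrow> nat \<Rightarrow> nat \<Rightarrow> nat list set" where
  "words \<kappa> k m i = {zs. set zs \<subseteq> {0, 1} \<and> count_list zs 1 = m \<and> count_list zs 0 = i \<and>
     \<not> sublist (replicate \<kappa> 1) zs \<and> sublist (replicate k 0) zs}"

lemma length_words: "zs \<in> words \<kappa> k m i \<Longrightarrow> length zs = m + i"
  using sum_count_set[of zs "{0, 1}"] by (auto simp: words_def)

lemma finite_words: "finite (words \<kappa> k m i)"
proof (rule finite_subset)
  show "words \<kappa> k m i \<subseteq> {zs. set zs \<subseteq> {0, 1} \<and> length zs = m + i}"
    using length_words by (auto simp: words_def)
qed (simp add: finite_lists_length_eq)

lemma bij_betw_failure_first:
  assumes "1 \<le> \<kappa>" "1 \<le> k"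
  shows "bij_betw (\<lambda>(xs, ys). weave 0 1 ys xs)
    {(xs, ys). admissible \<kappa> k m i xs ys \<and> alternating ys xs} {zs \<in> words \<kappa> k m i. hd zs = 0}"
proof -
  have words: "bij_betw (\<lambda>(ys, xs). weave (0::nat) 1 ys xs)
    {p \<in> {(ys, xs). composition ys \<and> composition xs \<and> alternating ys xs}.
      case p of (ys, xs) \<Rightarrow> admissible \<kappa> k m i xs ys}
    {zs \<in> {zs. set zs \<subseteq> {0, 1} \<and> (zs = [] \<or> hd zs = 0)}. zs \<in> words \<kappa> k m i}"
  proof (rule bij_betw_Collect[OF bij_betw_weave], simp, clarify)
    fix ys xs assume *: "composition ys" "composition xs" "alternating ys xs"
    have "set (weave (0::nat) 1 ys xs) \<subseteq> {0, 1}"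
      using set_weave[of "0::nat" 1 ys xs] by auto
    moreover have "count_list (weave (0::nat) 1 ys xs) 0 = sum_list ys"
      "count_list (weave (0::nat) 1 ys xs) 1 = sum_list xs"
      using count_weave[of "0::nat" 1 ys xs] * by simp_all
    moreover have "sublist (replicate \<kappa> 1) (weave (0::nat) 1 ys xs) \<longleftrightarrow> (\<exists>x\<in>set xs. \<kappa> \<le> x)"
      "sublist (replicate k 0) (weave (0::nat) 1 ys xs) \<longleftrightarrow> (\<exists>y\<in>set ys. k \<le> y)"
      using sublist_replicate_weave[of "0::nat" 1 ys xs] * assms by simp_all
    ultimately show "weave (0::nat) 1 ys xs \<in> words \<kappa> k m i \<longleftrightarrow> admissible \<kappa> k m i xs ys"
      using * unfolding words_def admissible_def by (auto simp: not_le simp del: One_nat_def)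
  qed
  have start: "{zs \<in> {zs. set zs \<subseteq> {0, 1} \<and> (zs = [] \<or> hd zs = 0)}. zs \<in> words \<kappa> k m i} =
      {zs \<in> words \<kappa> k m i. hd zs = 0}"
    using assms by (auto simp: words_def)
  have swap: "bij_betw prod.swap {(xs, ys). admissible \<kappa> k m i xs ys \<and> alternating ys xs}
    {p \<in> {(ys, xs). composition ys \<and> composition xs \<and> alternating ys xs}.
      case p of (ys, xs) \<Rightarrow> admissible \<kappa> k m i xs ys}"
    by (rule bij_betwI[where g = prod.swap]) (auto simp: admissible_def)
  have "bij_betw ((\<lambda>(ys, xs). weave (0::nat) 1 ys xs) \<circ> prod.swap)
    {(xs, ys). admissible \<kappa> k m i xs ys \<and> alternating ys xs} {zs \<in> words \<kappa> k m i. hd zs = 0}"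
    using swap words[unfolded start] by (rule bij_betw_trans)
  moreover have "(\<lambda>(ys, xs). weave (0::nat) 1 ys xs) \<circ> prod.swap = (\<lambda>(xs, ys). weave 0 1 ys xs)"
    by (simp add: fun_eq_iff)
  ultimately show ?thesis by simp
qed

lemma bij_betw_success_first:
  assumes "1 \<le> \<kappa>" "1 \<le> k"
  shows "bij_betw (\<lambda>(xs, ys). weave 1 0 xs ys)
    {(xs, ys). admissible \<kappa> k m i xs ys \<and> alternating xs ys} {zs \<in> words \<kappa> k m i. hd zs = 1}"
proof -
  have "bij_betw (\<lambda>(xs, ys). weave (1::nat) 0 xs ys)
    {p \<in> {(xs, ys). composition xs \<and> composition ys \<and> alternating xs ys}.
      case p of (xs, ys) \<Rightarrow> admissible \<kappa> k m i xs ys}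
    {zs \<in> {zs. set zs \<subseteq> {1, 0} \<and> (zs = [] \<or> hd zs = 1)}. zs \<in> words \<kappa> k m i}"
  proof (rule bij_betw_Collect[OF bij_betw_weave], simp, clarify)
    fix xs ys assume *: "composition xs" "composition ys" "alternating xs ys"
    have "set (weave (1::nat) 0 xs ys) \<subseteq> {0, 1}"
      using set_weave[of "1::nat" 0 xs ys] by auto
    moreover have "count_list (weave (1::nat) 0 xs ys) 1 = sum_list xs"
      "count_list (weave (1::nat) 0 xs ys) 0 = sum_list ys"
      using count_weave[of "1::nat" 0 xs ys] * by simp_all
    moreover have "sublist (replicate \<kappa> 1) (weave (1::nat) 0 xs ys) \<longleftrightarrow> (\<exists>x\<in>set xs. \<kappa> \<le> x)"
      "sublist (replicate k 0) (weave (1::nat) 0 xs ys) \<longleftrightarrow> (\<exists>y\<in>set ys. k \<le> y)"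
      using sublist_replicate_weave[of "1::nat" 0 xs ys] * assms by simp_all
    ultimately show "weave (1::nat) 0 xs ys \<in> words \<kappa> k m i \<longleftrightarrow> admissible \<kappa> k m i xs ys"
      using * unfolding words_def admissible_def by (auto simp: not_le simp del: One_nat_def)
  qed
  moreover have "{zs \<in> {zs. set zs \<subseteq> {1, 0} \<and> (zs = [] \<or> hd zs = 1)}. zs \<in> words \<kappa> k m i} =
      {zs \<in> words \<kappa> k m i. hd zs = 1}"
    using assms by (auto simp: words_def)
  moreover have "{p \<in> {(xs, ys). composition xs \<and> composition ys \<and> alternating xs ys}.
      case p of (xs, ys) \<Rightarrow> admissible \<kappa> k m i xs ys} =
      {(xs, ys). admissible \<kappa> k m i xs ys \<and> alternating xs ys}"
    by (auto simp: admissible_def)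
  ultimately show ?thesis by simp
qed

text \<open>Words starting with a failure have as many success runs as failure runs or one fewer, which
  gives \<open>M\<close> and \<open>E\<close>; words starting with a success have as many or one more, which gives \<open>F\<close>
  and \<open>N\<close>.\<close>

lemma sum_words:
  assumes "1 \<le> \<kappa>" "1 \<le> k"
  shows "(\<Sum>zs \<in> words \<kappa> k m i. q ^ crossings 0 zs) =
    (\<Sum>s=1..i-k+1. M_sum q k \<kappa> m i s + E_sum q k \<kappa> m i s
      + N_sum q k \<kappa> m i (s + 1) + F_sum q k \<kappa> m i s)"
proof -
  let ?A = "\<lambda>xs ys. admissible \<kappa> k m i xs ys"
  have fin: "finite {(xs, ys). ?A xs ys \<and> P xs ys}" for P
    by (rule finite_subset[OF _ finite_admissible[of \<kappa> k m i]]) auto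
  have ME: "(\<Sum>s=1..i-k+1. M_sum q k \<kappa> m i s + E_sum q k \<kappa> m i s) =
      (\<Sum>zs \<in> {zs \<in> words \<kappa> k m i. hd zs = 0}. q ^ crossings 0 zs)"
  proof -
    let ?h = "\<lambda>(xs, ys). q ^ crossings 0 (weave 0 1 ys xs)"
    have "M_sum q k \<kappa> m i s + E_sum q k \<kappa> m i s =
        sum ?h {(xs, ys). ?A xs ys \<and> alternating ys xs \<and> length ys = s}" if "1 \<le> s" for s
    proof -
      have "{(xs, ys). ?A xs ys \<and> alternating ys xs \<and> length ys = s} =
          {(xs, ys). ?A xs ys \<and> length xs = s \<and> length ys = s} \<union>
          {(xs, ys). ?A xs ys \<and> length xs = s - 1 \<and> length ys = s}"
        using that by (auto simp: alternating_def)
      moreover have "{(xs, ys). ?A xs ys \<and> length xs = s \<and> length ys = s} \<inter>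
          {(xs, ys). ?A xs ys \<and> length xs = s - 1 \<and> length ys = s} = {}"
        using that by auto
      ultimately show ?thesis
        using M_sum_eq[OF assms(2) that] E_sum_eq[OF assms(2) that]
        by (simp add: sum.union_disjoint fin)
    qed
    then have "(\<Sum>s=1..i-k+1. M_sum q k \<kappa> m i s + E_sum q k \<kappa> m i s) =
        sum ?h {(xs, ys). ?A xs ys \<and> alternating ys xs}"
      by (rule sum_by_number_of_failure_runs)
    also have "\<dots> = (\<Sum>zs \<in> {zs \<in> words \<kappa> k m i. hd zs = 0}. q ^ crossings 0 zs)"
      using sum.reindex_bij_betw[OF bij_betw_failure_first[OF assms], of "\<lambda>zs. q ^ crossings 0 zs"]
      by (simp add: split_def)
    finally show ?thesis .
  qed
  have NF: "(\<Sum>s=1..i-k+1. N_sum q k \<kappa> m i (s + 1) + F_sum q k \<kappa> m i s) =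
      (\<Sum>zs \<in> {zs \<in> words \<kappa> k m i. hd zs = 1}. q ^ crossings 0 zs)"
  proof -
    let ?h = "\<lambda>(xs, ys). q ^ crossings 0 (weave 1 0 xs ys)"
    have "N_sum q k \<kappa> m i (s + 1) + F_sum q k \<kappa> m i s =
        sum ?h {(xs, ys). ?A xs ys \<and> alternating xs ys \<and> length ys = s}" if "1 \<le> s" for s
    proof -
      have "{(xs, ys). ?A xs ys \<and> alternating xs ys \<and> length ys = s} =
          {(xs, ys). ?A xs ys \<and> length xs = s + 1 \<and> length ys = s} \<union>
          {(xs, ys). ?A xs ys \<and> length xs = s \<and> length ys = s}"
        by (auto simp: alternating_def)
      moreover have "{(xs, ys). ?A xs ys \<and> length xs = s + 1 \<and> length ys = s} \<inter>
          {(xs, ys). ?A xs ys \<and> length xs = s \<and> length ys = s} = {}"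
        by auto
      ultimately show ?thesis
        using N_sum_Suc_eq[OF assms(2) that] F_sum_eq[OF assms(2) that]
        by (simp add: sum.union_disjoint fin)
    qed
    then have "(\<Sum>s=1..i-k+1. N_sum q k \<kappa> m i (s + 1) + F_sum q k \<kappa> m i s) =
        sum ?h {(xs, ys). ?A xs ys \<and> alternating xs ys}"
      by (rule sum_by_number_of_failure_runs)
    also have "\<dots> = (\<Sum>zs \<in> {zs \<in> words \<kappa> k m i. hd zs = 1}. q ^ crossings 0 zs)"
      using sum.reindex_bij_betw[OF bij_betw_success_first[OF assms], of "\<lambda>zs. q ^ crossings 0 zs"]
      by (simp add: split_def)
    finally show ?thesis .
  qed
  have "hd zs \<in> {0, 1}" if "zs \<in> words \<kappa> k m i" for zs
    using that assms by (cases zs) (auto simp: words_def)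
  then have "sum f (words \<kappa> k m i) =
      sum f ({zs \<in> words \<kappa> k m i. hd zs = 0} \<union> {zs \<in> words \<kappa> k m i. hd zs = 1})" for f :: "nat list \<Rightarrow> real"
    by (intro sum.cong) auto
  then have "(\<Sum>zs \<in> words \<kappa> k m i. q ^ crossings 0 zs) =
      (\<Sum>zs \<in> {zs \<in> words \<kappa> k m i. hd zs = 0}. q ^ crossings 0 zs) +
      (\<Sum>zs \<in> {zs \<in> words \<kappa> k m i. hd zs = 1}. q ^ crossings 0 zs)"
    by (simp only:) (rule sum.union_disjoint, auto simp: finite_words)
  then show ?thesis
    unfolding ME[symmetric] NF[symmetric] by (simp add: sum.distrib add.assoc)
qed

section \<open>The probability of a word\<close>

lemma (in q_bernoulli_trials) trial_measurable:
  assumes "l \<ge> 1"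
  shows "{\<omega> \<in> space M. X l \<omega> = c} \<in> events"
proof -
  have "{\<omega> \<in> space M. X l \<omega> = c} = X l -` ({c} \<inter> {0, 1}) \<inter> space M"
    using measurable_space[OF X_measurable[OF assms]] by auto
  also have "\<dots> \<in> events"
    using X_measurable[OF assms] by (rule measurable_sets) simp
  finally show ?thesis .
qed

text \<open>By induction on the number of trials, multiplying by one conditional probability at a time.\<close>

lemma (in q_bernoulli_trials) prob_path:
  assumes "\<forall>l\<in>{1..n}. x l \<in> {0, 1}"
  shows "\<P>(\<omega> in M. \<forall>l\<in>{1..<Suc n}. X l \<omega> = x l)
    = \<theta> ^ count_list (map x [1..<Suc n]) 1
      * (\<Prod>j=1..count_list (map x [1..<Suc n]) 0. 1 - \<theta> * q ^ (j - 1))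
      * q ^ crossings 0 (map x [1..<Suc n])"
  using assms
proof (induction n)
  case 0
  show ?case by (simp add: prob_space)
next
  case (Suc n)
  let ?zs = "map x [1..<Suc n]"
  let ?H = "\<lambda>\<omega>. \<forall>l\<in>{1..<Suc n}. X l \<omega> = x l"
  let ?p = "if x (Suc n) = 0 then 1 - \<theta> * q ^ count_list ?zs 0 else \<theta> * q ^ count_list ?zs 0"
  have measH: "{\<omega> \<in> space M. ?H \<omega>} \<in> events"
    by (intro sets.sets_Collect_finite_All trial_measurable) auto
  have split: "(\<forall>l\<in>{1..<Suc (Suc n)}. X l \<omega> = x l) \<longleftrightarrow> X (Suc n) \<omega> = x (Suc n) \<and> ?H \<omega>" for \<omega>
    by (auto simp: less_Suc_eq)
  have card: "card {l \<in> {1..<Suc n}. x l = 0} = count_list ?zs 0"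
  proof (induction n)
    case (Suc n)
    have "{l \<in> {1..<Suc (Suc n)}. x l = 0} =
        {l \<in> {1..<Suc n}. x l = 0} \<union> (if x (Suc n) = 0 then {Suc n} else {})"
      by (auto simp: less_Suc_eq)
    then show ?case using Suc by (auto simp: card_insert_if)
  qed simp
  have "\<P>(\<omega> in M. \<forall>l\<in>{1..<Suc (Suc n)}. X l \<omega> = x l) = ?p * \<P>(\<omega> in M. ?H \<omega>)"
  proof (cases "\<P>(\<omega> in M. ?H \<omega>) > 0")
    case True
    have "\<P>(\<omega> in M. X (Suc n) \<omega> = x (Suc n) \<bar> ?H \<omega>) = ?p"
    proof (cases "x (Suc n) = 0")
      case eq: True
      then show ?thesis
        using X_failure[OF _ True, unfolded card] by (simp del: upt_Suc)
    next
      case False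
      then have "x (Suc n) = 1" using Suc.prems by force
      then show ?thesis
        using X_success[OF _ True, unfolded card] by (simp del: upt_Suc)
    qed
    with True show ?thesis
      unfolding split by (simp add: cond_prob_def field_simps)
  next
    case False
    \<comment> \<open>Nothing is known about the next trial after a history of probability \<open>0\<close>, but then both
      sides vanish.\<close>
    then have zero: "\<P>(\<omega> in M. ?H \<omega>) = 0"
      using zero_less_measure_iff[of M] by blast
    moreover have "\<P>(\<omega> in M. \<forall>l\<in>{1..<Suc (Suc n)}. X l \<omega> = x l) \<le> \<P>(\<omega> in M. ?H \<omega>)"
      unfolding split using measH by (intro finite_measure_mono) auto
    ultimately show ?thesis
      by (simp add: measure_le_0_iff)
  qed
  also have "\<P>(\<omega> in M. ?H \<omega>) = \<theta> ^ count_list ?zs 1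
      * (\<Prod>j=1..count_list ?zs 0. 1 - \<theta> * q ^ (j - 1)) * q ^ crossings 0 ?zs"
    using Suc by simp
  finally show ?case
    using Suc.prems[rule_format, of "Suc n"]
    by (auto simp: crossings_append_single power_add)
qed

lemma (in q_bernoulli_trials) prob_word:
  assumes "set zs \<subseteq> {0, 1}" "length zs = n"
  shows "{\<omega> \<in> space M. map (\<lambda>j. X j \<omega>) [1..<Suc n] = zs} \<in> events"
    and "\<P>(\<omega> in M. map (\<lambda>j. X j \<omega>) [1..<Suc n] = zs) =
      \<theta> ^ count_list zs 1 * (\<Prod>j=1..count_list zs 0. 1 - \<theta> * q ^ (j - 1)) * q ^ crossings 0 zs"
proof -
  let ?x = "\<lambda>l. zs ! (l - 1)"
  have zs: "map ?x [1..<Suc n] = zs"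
    using assms(2) by (auto simp: list_eq_iff_nth_eq simp del: upt_Suc)
  have iff: "map (\<lambda>j. X j \<omega>) [1..<Suc n] = zs \<longleftrightarrow> (\<forall>l\<in>{1..<Suc n}. X l \<omega> = ?x l)" for \<omega>
    by (subst (1) zs[symmetric]) (simp add: map_eq_conv del: upt_Suc)
  have letters: "?x l \<in> {0, 1}" if "l \<in> {1..n}" for l
  proof -
    have "l - 1 < length zs"
      using that assms(2) by auto
    then show ?thesis
      using assms(1) nth_mem by blast
  qed
  show "\<P>(\<omega> in M. map (\<lambda>j. X j \<omega>) [1..<Suc n] = zs) =
      \<theta> ^ count_list zs 1 * (\<Prod>j=1..count_list zs 0. 1 - \<theta> * q ^ (j - 1)) * q ^ crossings 0 zs"
    unfolding iff using prob_path[of n ?x, OF ballI, OF letters] unfolding zs .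
  show "{\<omega> \<in> space M. map (\<lambda>j. X j \<omega>) [1..<Suc n] = zs} \<in> events"
    unfolding iff by (intro sets.sets_Collect_finite_All trial_measurable) auto
qed

lemma (in q_bernoulli_trials) prob_word_mem:
  assumes "\<And>zs. zs \<in> Z \<Longrightarrow> set zs \<subseteq> {0, 1} \<and> length zs = n"
  shows "\<P>(\<omega> in M. map (\<lambda>j. X j \<omega>) [1..<Suc n] \<in> Z) =
    (\<Sum>zs\<in>Z. \<theta> ^ count_list zs 1 * (\<Prod>j=1..count_list zs 0. 1 - \<theta> * q ^ (j - 1)) * q ^ crossings 0 zs)"
proof -
  let ?A = "\<lambda>zs. {\<omega> \<in> space M. map (\<lambda>j. X j \<omega>) [1..<Suc n] = zs}"
  have "finite Z"
    by (rule finite_subset[of _ "{zs. set zs \<subseteq> {0, 1} \<and> length zs = n}"])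
      (use assms in \<open>auto simp: finite_lists_length_eq\<close>)
  moreover have "?A ` Z \<subseteq> events"
    using assms prob_word(1) by blast
  moreover have "disjoint_family_on ?A Z"
    unfolding disjoint_family_on_def by blast
  ultimately have union: "prob (\<Union>zs\<in>Z. ?A zs) = (\<Sum>zs\<in>Z. prob (?A zs))"
    by (rule finite_measure_finite_Union)
  have event: "(\<Union>zs\<in>Z. ?A zs) = {\<omega> \<in> space M. map (\<lambda>j. X j \<omega>) [1..<Suc n] \<in> Z}"
    by blast
  have words: "(\<Sum>zs\<in>Z. prob (?A zs)) = (\<Sum>zs\<in>Z. \<theta> ^ count_list zs 1
      * (\<Prod>j=1..count_list zs 0. 1 - \<theta> * q ^ (j - 1)) * q ^ crossings 0 zs)"
    using assms prob_word(2) by (intro sum.cong) auto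
  show ?thesis
    using union unfolding event words .
qed

theorem theorem7p2:
  fixes M :: "'a measure" and X :: "nat \<Rightarrow> 'a \<Rightarrow> nat"
    and q \<theta> :: real and k1 k2 n :: nat
  assumes "0 \<le> \<theta>" "\<theta> \<le> 1" "0 < q" "q < 1"
    and "q_bernoulli_trials M X q \<theta>"
    and "k1 \<ge> 1" "k2 \<ge> 1" "n \<ge> k2"
  shows "\<P>(\<omega> in M. longest_run (\<lambda>j. X j \<omega>) 1 n \<le> k1 \<and> longest_run (\<lambda>j. X j \<omega>) 0 n \<ge> k2)
    = (\<Sum>i=k2..n. \<theta> ^ (n - i) * (\<Prod>j=1..i. 1 - \<theta> * q ^ (j - 1)) *
        (\<Sum>s=1..i-k2+1. M_sum q k2 (k1 + 1) (n - i) i s + E_sum q k2 (k1 + 1) (n - i) i s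
           + N_sum q k2 (k1 + 1) (n - i) i (s + 1) + F_sum q k2 (k1 + 1) (n - i) i s))"
proof -
  interpret q_bernoulli_trials M X q \<theta> by fact
  let ?w = "\<lambda>zs. \<theta> ^ count_list zs 1 * (\<Prod>j=1..count_list zs 0. 1 - \<theta> * q ^ (j - 1)) * q ^ crossings 0 zs"
  let ?Z = "{zs. set zs \<subseteq> {0, 1} \<and> length zs = n \<and>
    \<not> sublist (replicate (k1 + 1) 1) zs \<and> sublist (replicate k2 0) zs}"
  have event: "longest_run (\<lambda>j. X j \<omega>) 1 n \<le> k1 \<and> longest_run (\<lambda>j. X j \<omega>) 0 n \<ge> k2 \<longleftrightarrow>
      map (\<lambda>j. X j \<omega>) [1..<Suc n] \<in> ?Z" if "\<omega> \<in> space M" for \<omega>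
  proof -
    have "set (map (\<lambda>j. X j \<omega>) [1..<Suc n]) \<subseteq> {0, 1}"
    proof -
      have "X j \<omega> \<in> {0, 1}" if "j \<in> {1..<Suc n}" for j
        using measurable_space[OF X_measurable \<open>\<omega> \<in> space M\<close>] that by auto
      then show ?thesis
        unfolding set_map set_upt by (rule image_subsetI)
    qed
    moreover have "longest_run (\<lambda>j. X j \<omega>) 1 n \<le> k1 \<longleftrightarrow> \<not> k1 + 1 \<le> longest_run (\<lambda>j. X j \<omega>) 1 n"
      by linarith
    ultimately show ?thesis
      by (simp add: longest_run_ge_iff del: upt_Suc One_nat_def replicate_Suc)
  qed
  have fin: "finite ?Z"
    by (rule finite_subset[of _ "{zs. set zs \<subseteq> {0, 1} \<and> length zs = n}"])
      (auto simp: finite_lists_length_eq)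
  have "count_list zs 0 \<in> {k2..n}" if "zs \<in> ?Z" for zs
  proof -
    from that obtain us vs where "zs = us @ replicate k2 0 @ vs"
      by (auto simp: sublist_def)
    then have "k2 \<le> count_list zs 0" by (simp add: count_list_replicate)
    moreover have "count_list zs 0 \<le> n" using count_le_length[of zs 0] that by simp
    ultimately show ?thesis by simp
  qed
  then have range: "(\<lambda>zs. count_list zs 0) ` ?Z \<subseteq> {k2..n}" by blast
  \<comment> \<open>The letters other than zeros are ones, so fixing the length fixes their number.\<close>
  have slice: "{zs \<in> ?Z. count_list zs 0 = i} = words (k1 + 1) k2 (n - i) i" if "i \<in> {k2..n}" for i
  proof -
    have "length zs = n \<and> count_list zs 0 = i \<longleftrightarrow> count_list zs 1 = n - i \<and> count_list zs 0 = i"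
      if "set zs \<subseteq> {0, 1}" for zs :: "nat list"
      using sum_count_set[OF that] \<open>i \<in> {k2..n}\<close> by auto
    then show ?thesis unfolding words_def by blast
  qed
  have "\<P>(\<omega> in M. longest_run (\<lambda>j. X j \<omega>) 1 n \<le> k1 \<and> longest_run (\<lambda>j. X j \<omega>) 0 n \<ge> k2) =
      \<P>(\<omega> in M. map (\<lambda>j. X j \<omega>) [1..<Suc n] \<in> ?Z)"
    using event by (metis (no_types, lifting))
  also have "\<dots> = sum ?w ?Z"
    by (rule prob_word_mem) blast
  also have "\<dots> = (\<Sum>i=k2..n. sum ?w {zs \<in> ?Z. count_list zs 0 = i})"
    by (rule sum.group[OF fin _ range, symmetric]) simp
  also have "\<dots> = (\<Sum>i=k2..n. \<theta> ^ (n - i) * (\<Prod>j=1..i. 1 - \<theta> * q ^ (j - 1)) *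
      (\<Sum>zs \<in> words (k1 + 1) k2 (n - i) i. q ^ crossings 0 zs))"
  proof (rule sum.cong[OF refl])
    fix i assume "i \<in> {k2..n}"
    show "sum ?w {zs \<in> ?Z. count_list zs 0 = i} = \<theta> ^ (n - i) * (\<Prod>j=1..i. 1 - \<theta> * q ^ (j - 1)) *
        (\<Sum>zs \<in> words (k1 + 1) k2 (n - i) i. q ^ crossings 0 zs)"
      unfolding slice[OF \<open>i \<in> {k2..n}\<close>] sum_distrib_left
      by (rule sum.cong) (auto simp: words_def)
  qed
  also have "\<dots> = (\<Sum>i=k2..n. \<theta> ^ (n - i) * (\<Prod>j=1..i. 1 - \<theta> * q ^ (j - 1)) *
        (\<Sum>s=1..i-k2+1. M_sum q k2 (k1 + 1) (n - i) i s + E_sum q k2 (k1 + 1) (n - i) i s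
           + N_sum q k2 (k1 + 1) (n - i) i (s + 1) + F_sum q k2 (k1 + 1) (n - i) i s))"
    using assms by (intro sum.cong refl arg_cong2[of _ _ _ _ "(*)"] sum_words) auto
  finally show ?thesis .
qed

end
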